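(* For every $k\ge1$, the image of the annular transfer map $\mathcal A_k$ is the exit set $E_{k+1}$: $$\operatorname{im}(\mathcal A_k)=E_{k+1}.$$
   Context: $\tau(n)$ is the number of positive divisors of $n$; $T(n)=n+\tau(n)$ on the positive integers, and $T^s$ is the $s$-th iterate. For $k\ge1$, every $T$-orbit starting in $[k^2,(k+1)^2)$ is strictly increasing and its first value $\ge (k+1)^2$ lies in $[(k+1)^2,(k+2)^2)$. The annular transfer map $\mathcal A_k:\{0,1,\dots,2k\}\to\{0,1,\dots,2k+2\}$ is defined as follows: for $0\le r\le 2k$, let $s\ge1$ be minimal with $T^s(k^2+r)\ge (k+1)^2$; then $\mathcal A_k(r)=T^s(k^2+r)-(k+1)^2$. For $k\ge2$ the exit set is $$E_k=\{\tau(k^2-j)-j:\ 1\le j\le 2k-2,\ \tau(k^2-j)\ge j\}.$$ *)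

theory Defs
  imports Main
begin

definition tau :: "nat \<Rightarrow> nat" where
  "tau n = card {d. d dvd n}"

definition T :: "nat \<Rightarrow> nat" where
  "T n = n + tau n"

(* For k >= 1 the set minimised over is nonempty (see ex_exit_time below). *)
definition exit_time :: "nat \<Rightarrow> nat \<Rightarrow> nat" where
  "exit_time k r = (LEAST s. 1 \<le> s \<and> (k + 1)\<^sup>2 \<le> (T ^^ s) (k\<^sup>2 + r))"

(* Meaningful for k >= 1 and r <= 2 * k; the subtraction does not truncate there
   (see exit_time_exits below). *)
definition annular_transfer :: "nat \<Rightarrow> nat \<Rightarrow> nat" where
  "annular_transfer k r = (T ^^ exit_time k r) (k\<^sup>2 + r) - (k + 1)\<^sup>2"

(* Meaningful for k >= 2; no subtraction truncates there. *)
definition exit_set :: "nat \<Rightarrow> nat set" where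
  "exit_set k = {tau (k\<^sup>2 - j) - j | j. 1 \<le> j \<and> j \<le> 2 * k - 2 \<and> j \<le> tau (k\<^sup>2 - j)}"

lemma T_gt: "0 < n \<Longrightarrow> n < T n"
proof -
  assume "0 < n"
  then have "finite {d. d dvd n}" by simp
  moreover have "1 \<in> {d. d dvd n}" by simp
  ultimately show ?thesis
    unfolding T_def tau_def by (metis card_gt_0_iff empty_iff less_add_same_cancel1)
qed

lemma T_funpow_ge: "0 < n \<Longrightarrow> n + s \<le> (T ^^ s) n"
proof (induction s)
  case (Suc s)
  then have "n + s \<le> (T ^^ s) n" by simp
  moreover from this Suc.prems have "(T ^^ s) n < T ((T ^^ s) n)" by (intro T_gt) simp
  ultimately show ?case by simp
qed simp

lemma ex_exit_time:
  assumes "1 \<le> k"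
  shows "\<exists>s\<ge>1. (k + 1)\<^sup>2 \<le> (T ^^ s) (k\<^sup>2 + r)"
proof -
  have "(k\<^sup>2 + r) + (k + 1)\<^sup>2 \<le> (T ^^ ((k + 1)\<^sup>2)) (k\<^sup>2 + r)"
    using assms by (intro T_funpow_ge) simp
  then show ?thesis by (intro exI[of _ "(k + 1)\<^sup>2"]) simp
qed

lemma exit_time_exits:
  assumes "1 \<le> k"
  shows "1 \<le> exit_time k r" "(k + 1)\<^sup>2 \<le> (T ^^ exit_time k r) (k\<^sup>2 + r)"
  using LeastI_ex[OF ex_exit_time[OF assms, of r]] unfolding exit_time_def by blast+

end

theory Submission
  imports Defs
begin

text \<open>
  The value of the transfer map depends only on the last orbit point \<open>m\<close> below \<open>(k + 1)\<^sup>2\<close>. Writing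
  \<open>m = (k + 1)\<^sup>2 - j\<close>, the exit value is \<open>T m - (k + 1)\<^sup>2 = tau m - j\<close>, and the fact that \<open>m\<close> exits says
  \<open>j \<le> tau m\<close>. Conversely, a point \<open>m\<close> of the annulus that exits in one step is the last point of its
  own orbit, so its exit value is attained by starting at \<open>m\<close>.

  The annulus corresponds to \<open>1 \<le> j \<le> 2 * k + 1\<close>, whereas the exit set for \<open>k + 1\<close> stops at
  \<open>j = 2 * k\<close>. The remaining index \<open>j = 2 * k + 1\<close> is the point \<open>m = k\<^sup>2\<close>, which never exits in one
  step: pairing each divisor with its cofactor gives \<open>tau (k\<^sup>2) \<le> 2 * k\<close> (lemma \<open>tau_le\<close>).
\<close>

text \<open>
  Of two complementary divisors \<open>d\<close> and \<open>n div d\<close>, at least one is at most \<open>k\<close>, since otherwise their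
  product would reach \<open>(k + 1)\<^sup>2\<close>.
\<close>
lemma tau_le:
  assumes "0 < n" and "n < (k + 1)\<^sup>2"
  shows "tau n \<le> 2 * k"
proof -
  have "{d. d dvd n} \<subseteq> {1..k} \<union> (\<lambda>d. n div d) ` {1..k}"
  proof
    fix d assume "d \<in> {d. d dvd n}"
    then obtain e where e: "n = d * e" by auto
    with assms(1) have pos: "0 < d" "0 < e" by auto
    have "d \<le> k \<or> e \<le> k"
    proof (rule ccontr)
      assume "\<not> (d \<le> k \<or> e \<le> k)"
      then have "(k + 1) * (k + 1) \<le> d * e" by (intro mult_le_mono) auto
      with assms(2) e show False by (simp add: power2_eq_square)
    qed
    moreover have "d = n div e" using e pos by simp
    ultimately show "d \<in> {1..k} \<union> (\<lambda>d. n div d) ` {1..k}"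
      using pos by auto
  qed
  then have "tau n \<le> card ({1..k} \<union> (\<lambda>d. n div d) ` {1..k})"
    unfolding tau_def by (intro card_mono) auto
  also have "\<dots> \<le> card {1..k} + card ((\<lambda>d. n div d) ` {1..k})"
    by (rule card_Un_le)
  also have "\<dots> \<le> k + k"
    using card_image_le[of "{1..k}" "\<lambda>d. n div d"] by simp
  finally show ?thesis by simp
qed

text \<open>
  Minimality of the exit time, together with monotonicity of the orbit, places the penultimate
  point inside the annulus.
\<close>
lemma annular_transfer_last_point:
  assumes "1 \<le> k" and "r \<le> 2 * k"
  obtains m where "k\<^sup>2 \<le> m" and "m < (k + 1)\<^sup>2" and "(k + 1)\<^sup>2 \<le> T m"
    and "annular_transfer k r = T m - (k + 1)\<^sup>2"
proof -
  obtain s where s: "exit_time k r = Suc s"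
    using exit_time_exits(1)[OF assms(1), of r] by (cases "exit_time k r") auto
  define m where "m = (T ^^ s) (k\<^sup>2 + r)"
  have ge: "k\<^sup>2 \<le> m"
    using T_funpow_ge[of "k\<^sup>2 + r" s] assms(1) by (simp add: m_def)
  have lt: "m < (k + 1)\<^sup>2"
  proof (cases "s = 0")
    case True
    then show ?thesis using assms(2) by (simp add: m_def power2_eq_square)
  next
    case False
    have "s < exit_time k r" using s by simp
    then have "\<not> (1 \<le> s \<and> (k + 1)\<^sup>2 \<le> (T ^^ s) (k\<^sup>2 + r))"
      unfolding exit_time_def by (rule not_less_Least)
    with False show ?thesis by (simp add: m_def)
  qed
  have "(k + 1)\<^sup>2 \<le> T m"
    using exit_time_exits(2)[OF assms(1), of r] by (simp add: s m_def)
  moreover have "annular_transfer k r = T m - (k + 1)\<^sup>2"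
    by (simp add: annular_transfer_def s m_def)
  ultimately show thesis using that ge lt by blast
qed

lemma annular_transfer_one_step:
  assumes "(k + 1)\<^sup>2 \<le> T (k\<^sup>2 + r)"
  shows "annular_transfer k r = T (k\<^sup>2 + r) - (k + 1)\<^sup>2"
proof -
  have "exit_time k r = 1"
    unfolding exit_time_def by (rule Least_equality) (use assms in auto)
  then show ?thesis by (simp add: annular_transfer_def)
qed

theorem proposition5p1:
  fixes k :: nat
  assumes "1 \<le> k"
  shows "annular_transfer k ` {0..2 * k} = exit_set (k + 1)"
proof
  have sq: "(k + 1)\<^sup>2 = k\<^sup>2 + 2 * k + 1" by (simp add: power2_eq_square)
  show "annular_transfer k ` {0..2 * k} \<subseteq> exit_set (k + 1)"
  proof
    fix x assume "x \<in> annular_transfer k ` {0..2 * k}"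
    then obtain r where "r \<le> 2 * k" and x: "x = annular_transfer k r" by auto
    then obtain m where m: "k\<^sup>2 \<le> m" "m < (k + 1)\<^sup>2" "(k + 1)\<^sup>2 \<le> T m"
      and xm: "x = T m - (k + 1)\<^sup>2"
      using annular_transfer_last_point[OF assms] by metis
    define j where "j = (k + 1)\<^sup>2 - m"
    have m_eq: "m = (k + 1)\<^sup>2 - j" and "1 \<le> j" using m(2) by (auto simp: j_def)
    moreover have "j \<le> tau m" using m(3) by (simp add: j_def T_def)
    moreover have "j \<le> 2 * k"
    proof -
      have "0 < m" using m(1) assms by (metis le_zero_eq neq0_conv not_one_le_zero power_eq_0_iff)
      then have "tau m \<le> 2 * k" using m(2) by (rule tau_le)
      with \<open>j \<le> tau m\<close> show ?thesis by simp
    qed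
    moreover have "x = tau m - j" using xm m(2) by (simp add: j_def T_def)
    ultimately show "x \<in> exit_set (k + 1)"
      unfolding exit_set_def by auto
  qed
  show "exit_set (k + 1) \<subseteq> annular_transfer k ` {0..2 * k}"
  proof
    fix x assume "x \<in> exit_set (k + 1)"
    then obtain j where j: "1 \<le> j" "j \<le> 2 * k" "j \<le> tau ((k + 1)\<^sup>2 - j)"
      and x: "x = tau ((k + 1)\<^sup>2 - j) - j"
      unfolding exit_set_def by auto
    define r where "r = 2 * k + 1 - j"
    have m: "k\<^sup>2 + r = (k + 1)\<^sup>2 - j" using j(2) sq by (simp add: r_def)
    have T: "T (k\<^sup>2 + r) = (k + 1)\<^sup>2 + x"
      using j x sq by (simp add: m T_def)
    then have "annular_transfer k r = x"
      using annular_transfer_one_step[of k r] by simp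
    moreover have "r \<in> {0..2 * k}" using j(1) by (simp add: r_def)
    ultimately show "x \<in> annular_transfer k ` {0..2 * k}" by blast
  qed
qed

end
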